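(* The 13-dimensional Cohn-Elkies linear programming bound (i.e., the Cohn-Elkies linear programming bound in $\mathbb{R}^{13}$) is greater than or equal to $\frac{1}{28}>0.03571428$.
   Context: Fourier transform on $\mathbb{R}^d$: $\widehat f(y)=\int_{\mathbb{R}^d} f(x)e^{-2\pi i\langle x,y\rangle}\,dx$, where $\langle x,y\rangle=x_1y_1+\cdots+x_dy_d$. A function $f:\mathbb{R}^d\to\mathbb{R}$ is rapidly decreasing if $f(x)=O\left((1+|x|)^{-k}\right)$ for all positive integers $k$; it is radial if $f(x)$ depends only on $|x|$. For fixed $r>0$ and positive integer $d$, the Cohn-Elkies linear programming bound in $\mathbb{R}^d$ is the infimum of $\left(\frac r2\right)^d f(0)$ over all radial, smooth, rapidly decreasing functions $f:\mathbb{R}^d\to\mathbb{R}$ such that $f(0)>0$; $\widehat f(0)\geq 1$; $f(x)\leq 0$ for all $|x|\geq r$; and $\widehat f(y)\geq 0$ for all $y\in\mathbb{R}^d$. This value does not depend on $r$ (by rescaling $f$). *)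

theory Defs
  imports "HOL-Analysis.Analysis" "HOL-Library.Landau_Symbols"
begin

definition fourier :: "(real ^ 'n \<Rightarrow> real) \<Rightarrow> real ^ 'n \<Rightarrow> complex" where
  "fourier f y =
     (\<integral>x. complex_of_real (f x) * exp (- (2 * complex_of_real pi * \<i> * complex_of_real (x \<bullet> y))) \<partial>lborel)"

primrec continuously_differentiable :: "nat \<Rightarrow> ('a::euclidean_space \<Rightarrow> real) \<Rightarrow> bool" where
  "continuously_differentiable 0 f \<longleftrightarrow> continuous_on UNIV f"
| "continuously_differentiable (Suc k) f \<longleftrightarrow>
     (\<forall>x. f differentiable (at x)) \<and>
     (\<forall>v. continuously_differentiable k (\<lambda>x. frechet_derivative f (at x) v))"

definition smooth :: "('a::euclidean_space \<Rightarrow> real) \<Rightarrow> bool" where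
  "smooth f \<longleftrightarrow> (\<forall>k. continuously_differentiable k f)"

(* Only f itself is required to decay, not its derivatives. *)
definition rapidly_decreasing :: "('a::euclidean_space \<Rightarrow> real) \<Rightarrow> bool" where
  "rapidly_decreasing f \<longleftrightarrow> (\<forall>k::nat. k > 0 \<longrightarrow> f \<in> O[at_infinity](\<lambda>x. 1 / (1 + norm x) ^ k))"

definition radial :: "('a::euclidean_space \<Rightarrow> real) \<Rightarrow> bool" where
  "radial f \<longleftrightarrow> (\<forall>x y. norm x = norm y \<longrightarrow> f x = f y)"

(* The transform of a real radial function is real-valued, so fourier f 0 >= 1 is
   a condition on the real part. *)
definition cohn_elkies_feasible :: "real \<Rightarrow> (real ^ 'n \<Rightarrow> real) \<Rightarrow> bool" where
  "cohn_elkies_feasible r f \<longleftrightarrow>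
     radial f \<and> smooth f \<and> rapidly_decreasing f \<and>
     f 0 > 0 \<and> Re (fourier f 0) \<ge> 1 \<and>
     (\<forall>x. norm x \<ge> r \<longrightarrow> f x \<le> 0) \<and>
     (\<forall>y. fourier f y \<in> \<real>\<^sub>\<ge>\<^sub>0)"

(* The dimension d is CARD('n). *)
definition cohn_elkies_bound :: "'n::finite itself \<Rightarrow> real \<Rightarrow> ereal" where
  "cohn_elkies_bound _ r =
     (INF f \<in> {f :: real ^ 'n \<Rightarrow> real. cohn_elkies_feasible r f}. ereal ((r / 2) ^ CARD('n) * f 0))"

end

theory Submission
  imports Defs "HOL-Computational_Algebra.Polynomial"
begin

text \<open>
  The lower bound comes from weak duality, with a dual certificate that lives on the integer
  lattice. After rescaling \<open>f\<close> to \<open>g x = f (r / 2 *\<^sub>R x)\<close>, the sign condition reads \<open>g x \<le> 0\<close> for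
  \<open>2 \<le> norm x\<close>. Give each integer point a weight that depends only on its reduction modulo 2, that
  is, on the set \<open>S\<close> of its odd coordinates. Poisson summation formally gives

    \<open>\<Sum>x\<in>\<int>\<^sup>n. w (x mod 2) g x = 2\<^sup>-\<^sup>n \<Sum>y\<in>(1/2)\<int>\<^sup>n. w' (2 y mod 2) fourier g y\<close>

  where \<open>w'\<close> is the transform of \<open>w\<close> on the group \<open>(\<int>/2)\<^sup>n\<close>. If \<open>w\<close> is nonnegative, takes the value 1
  at the empty set and vanishes on the nonempty sets with fewer than four elements, then every
  nonzero point of positive weight has norm at least 2, so the left side is at most \<open>g 0\<close>. If \<open>w'\<close> is
  nonnegative too, the right side is at least its term at 0. Hence
  \<open>2\<^sup>n g 0 \<ge> (\<Sum>S. w S) fourier g 0\<close>. The conditions on \<open>w\<close> are those of Delsarte's linear program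
  for binary codes of length \<open>n\<close> and minimum distance 4. In dimension 13 there is a feasible
  weight of total 2048/7, and \<open>(2048/7) / 2^13 = 1/28\<close>.

  The decay hypothesis concerns \<open>g\<close> but not its derivatives, so convergence of the series on the right
  is not immediate, and an approximation by finite sums avoids the question. The comb of point masses at the integer points that reduce to \<open>S\<close> is replaced by the
  trigonometric polynomial \<open>lattice_kernel S ^ N\<close>, a product of powers of squared cosines, which
  concentrates on these points as \<open>N\<close> grows. Its expansion into characters has finitely many terms with
  known signs, so that the right side of the formula becomes a finite sum of nonnegative terms
  (\<open>integral_combination_ge\<close>). On the left side, \<open>g\<close> is nonpositive and the kernel nonnegative outside
  the ball of radius 2, so only the ball matters for an upper bound, and there compactness shows that
  the origin alone contributes in the limit (\<open>integral_lattice_kernel_le\<close>). Comparison of the two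
  gives \<open>weighted_lattice_bound\<close>, which holds in every dimension.
\<close>

section \<open>Integrals of products and central binomial coefficients\<close>

lemma has_bochner_integral_prod_components:
  fixes h :: "'n::finite \<Rightarrow> real \<Rightarrow> real"
  assumes int: "\<And>i. has_bochner_integral lborel (h i) (c i)" and nonneg: "\<And>i u. 0 \<le> h i u"
  shows "has_bochner_integral lborel (\<lambda>x::real^'n. \<Prod>i\<in>UNIV. h i (x $ i)) (\<Prod>i\<in>UNIV. c i)"
proof (rule has_bochner_integral_nn_integral)
  have [measurable]: "h i \<in> borel_measurable borel" for i
    using borel_measurable_has_bochner_integral[OF int] by simp
  have c: "0 \<le> c i" for i
    using Bochner_Integration.integral_nonneg[of lborel "h i"] nonneg has_bochner_integral_integral_eq[OF int]
    by simp
  show "(\<lambda>x::real^'n. \<Prod>i\<in>UNIV. h i (x $ i)) \<in> borel_measurable lborel" by measurable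
  show "AE x in lborel. 0 \<le> (\<Prod>i\<in>UNIV. h i ((x::real^'n) $ i))" by (simp add: prod_nonneg nonneg)
  show "0 \<le> (\<Prod>i\<in>UNIV. c i)" by (simp add: prod_nonneg c)
  have inj: "inj (\<lambda>i::'n. axis i (1::real))" by (auto intro: injI simp: axis_eq_axis)
  have basis: "(Basis :: (real^'n) set) = range (\<lambda>i. axis i 1)" by (auto simp: Basis_vec_def)
  have "(\<Prod>i\<in>UNIV. h i (x $ i)) = (\<Prod>b\<in>Basis. h (axis_index b) (x \<bullet> b))" for x :: "real^'n"
    by (simp add: basis prod.reindex inj inner_axis axis_index_axis)
  then have "(\<integral>\<^sup>+x. ennreal (\<Prod>i\<in>UNIV. h i ((x::real^'n) $ i)) \<partial>lborel)
      = (\<integral>\<^sup>+x. (\<Prod>b\<in>Basis. ennreal (h (axis_index b) ((x::real^'n) \<bullet> b))) \<partial>lborel)"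
    by (simp add: prod_ennreal nonneg)
  also have "\<dots> = (\<Prod>b\<in>(Basis :: (real^'n) set). \<integral>\<^sup>+u. ennreal (h (axis_index b) u) \<partial>lborel)"
    by (rule nn_integral_lborel_prod) (auto simp: nonneg)
  also have "\<dots> = (\<Prod>i\<in>(UNIV::'n set). \<integral>\<^sup>+u. ennreal (h i u) \<partial>lborel)"
    by (simp add: basis prod.reindex inj axis_index_axis)
  also have "\<dots> = (\<Prod>i\<in>UNIV. ennreal (c i))"
    using int nonneg by (intro prod.cong) (auto simp: has_bochner_integral_iff nn_integral_eq_integral)
  also have "\<dots> = ennreal (\<Prod>i\<in>UNIV. c i)" by (simp add: prod_ennreal c)
  finally show "(\<integral>\<^sup>+x. ennreal (\<Prod>i\<in>UNIV. h i ((x::real^'n) $ i)) \<partial>lborel) = ennreal (\<Prod>i\<in>UNIV. c i)" .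
qed

text \<open>
  The mean value of \<open>cos (pi * t / 2) ^ (2 * N)\<close> over a period: the constant term in the binomial
  expansion of the cosine power.
\<close>
definition central_mean :: "nat \<Rightarrow> real" where
  "central_mean N = real ((2 * N) choose N) / 4 ^ N"

text \<open>The recursion that Wallis' integrals satisfy, which drives the induction below.\<close>
lemma central_mean_Suc: "(2 * real N + 2) * central_mean (Suc N) = (2 * real N + 1) * central_mean N"
proof -
  have mean: "central_mean M = fact (2 * M) / (fact M * fact M) / 4 ^ M" for M
    unfolding central_mean_def by (subst binomial_fact) simp_all
  have "fact (2 * Suc N) = 2 * (real N + 1) * ((2 * real N + 1) * fact (2 * N))"
    by (simp add: algebra_simps)
  moreover have "fact (Suc N) = (real N + 1) * fact N"
    by simp
  moreover have "real N + 1 \<noteq> 0" by linarith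
  ultimately show ?thesis
    unfolding mean by (simp add: divide_simps del: fact_Suc) (simp add: algebra_simps)
qed

text \<open>
  Wallis' reduction: the derivative of \<open>cos ^ (2 * N + 1) * sin\<close> relates the powers \<open>2 * N\<close> and
  \<open>2 * N + 2\<close>, and it contributes no boundary terms because \<open>sin * cos\<close> vanishes at integer multiples
  of a quarter period. Hence the same mean value results on every interval between
  integers and for every integer shift \<open>v\<close>.
\<close>
lemma integral_cos_power:
  fixes a b v :: int
  assumes "a \<le> b"
  shows "((\<lambda>t. cos (pi * (t - v) / 2) ^ (2 * N)) has_integral (b - a) * central_mean N) {real_of_int a..b}"
proof (induction N)
  case 0
  then show ?case using has_integral_const_real[of "1::real" "real_of_int a" b] assms
    by (simp add: central_mean_def del: has_integral_const_real)
next
  case (Suc N)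
  let ?\<theta> = "\<lambda>t::real. pi * (t - v) / 2"
  let ?G = "\<lambda>t. cos (?\<theta> t) ^ (2 * N + 1) * sin (?\<theta> t) * 2 / pi"
  have G0: "?G k = 0" for k :: int
  proof -
    have "sin (2 * ?\<theta> k) = 0"
      using sin_zero_iff_int2[of "2 * ?\<theta> k"] by (auto intro!: exI[of _ "k - v"])
    then have "2 * sin (?\<theta> k) * cos (?\<theta> k) = 0" by (simp only: sin_double)
    then show ?thesis by (simp only: mult_eq_0_iff) auto
  qed
  have "((\<lambda>t. (2 * N + 2) * cos (?\<theta> t) ^ (2 * Suc N) - (2 * N + 1) * cos (?\<theta> t) ^ (2 * N))
       has_integral ?G b - ?G a) {real_of_int a..b}"
  proof (rule fundamental_theorem_of_calculus)
    show "real_of_int a \<le> b" using assms by simp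
    fix x
    define c s where "c = cos (?\<theta> x)" and "s = sin (?\<theta> x)"
    have dc: "((\<lambda>t. cos (?\<theta> t)) has_real_derivative - s * (pi / 2)) (at x within {real_of_int a..b})"
      and ds: "((\<lambda>t. sin (?\<theta> t)) has_real_derivative c * (pi / 2)) (at x within {real_of_int a..b})"
      unfolding c_def s_def by (auto intro!: derivative_eq_intros)
    have "((\<lambda>t. cos (?\<theta> t) ^ (2 * N + 1) * sin (?\<theta> t) * (2 / pi)) has_real_derivative
        (c ^ (2 * N + 1) * (c * (pi / 2)) + (2 * N + 1) * (c ^ (2 * N) * (- s * (pi / 2))) * s) * (2 / pi))
        (at x within {real_of_int a..b})"
      using DERIV_cmult_right[OF DERIV_mult[OF DERIV_power[OF dc, of "2 * N + 1"] ds], of "2 / pi"]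
      by (simp add: c_def s_def algebra_simps)
    also have "(c ^ (2 * N + 1) * (c * (pi / 2)) + (2 * N + 1) * (c ^ (2 * N) * (- s * (pi / 2))) * s) * (2 / pi)
        = c ^ (2 * N) * (c\<^sup>2 - (2 * N + 1) * s\<^sup>2)"
      by (simp add: field_simps power2_eq_square)
    also have "s\<^sup>2 = 1 - c\<^sup>2" by (simp add: c_def s_def sin_squared_eq)
    also have "c ^ (2 * N) * (c\<^sup>2 - (2 * N + 1) * (1 - c\<^sup>2)) = (2 * N + 2) * c ^ (2 * Suc N) - (2 * N + 1) * c ^ (2 * N)"
      by (simp add: algebra_simps power2_eq_square)
    finally show "(?G has_vector_derivative (2 * N + 2) * cos (?\<theta> x) ^ (2 * Suc N) - (2 * N + 1) * cos (?\<theta> x) ^ (2 * N))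
       (at x within {real_of_int a..b})"
      by (simp add: has_real_derivative_iff_has_vector_derivative c_def)
  qed
  then have "((\<lambda>t. (2 * N + 2) * cos (?\<theta> t) ^ (2 * Suc N) - (2 * N + 1) * cos (?\<theta> t) ^ (2 * N))
       has_integral 0) {real_of_int a..b}" unfolding G0 by simp
  from has_integral_add[OF this has_integral_mult_right[OF Suc, of "2 * N + 1"]]
  have "((\<lambda>t. (2 * N + 2) * cos (?\<theta> t) ^ (2 * Suc N)) has_integral (2 * N + 1) * ((b - a) * central_mean N)) {real_of_int a..b}"
    by simp
  from has_integral_mult_right[OF this, of "1 / (2 * N + 2)"]
  have "((\<lambda>t. cos (?\<theta> t) ^ (2 * Suc N)) has_integral
      (b - a) * ((2 * real N + 1) * central_mean N / (2 * real N + 2))) {real_of_int a..b}"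
    by (simp add: mult_ac add_ac)
  also have "(2 * real N + 1) * central_mean N / (2 * real N + 2) = central_mean (Suc N)"
    by (subst central_mean_Suc [symmetric]) simp
  finally show ?case .
qed

text \<open>
  The mass of the kernels on a cell decays only polynomially in \<open>N\<close>, so whatever decays geometrically
  remains negligible after normalization.
\<close>
lemma central_mean_lower: "N > 0 \<Longrightarrow> 1 / (2 * real N) \<le> central_mean N"
  using central_binomial_lower_bound[of N] by (simp add: central_mean_def field_simps)

lemma central_mean_pos: "central_mean N > 0"
  by (simp add: central_mean_def)

lemma geometric_beats_power:
  assumes "0 \<le> q" "q < (1::real)"
  shows "(\<lambda>N. q ^ N * (2 * real N) ^ k) \<longlonglongrightarrow> 0"
  using assms
proof (induction k arbitrary: q)
  case 0
  then show ?case by (simp add: LIMSEQ_realpow_zero)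
next
  case (Suc k)
  define p where "p = sqrt q"
  have p: "0 \<le> p" "p < 1" "q = p * p" using Suc.prems by (simp_all add: p_def)
  have "(\<lambda>N. 2 * (real N * p ^ N) * (p ^ N * (2 * real N) ^ k)) \<longlonglongrightarrow> 2 * 0 * 0"
    using p powser_times_n_limit_0[of p] by (intro tendsto_mult tendsto_const Suc.IH) auto
  then show ?case by (simp add: p(3) power_mult_distrib mult_ac)
qed

section \<open>The kernels and where they peak\<close>

text \<open>
  It attains its maximum 1 exactly at the integer points whose odd coordinates are those in \<open>S\<close>; its
  powers, suitably normalized, approximate the comb on this coset of \<open>2\<int>\<^sup>n\<close>.
\<close>
definition lattice_kernel :: "'n set \<Rightarrow> real ^ 'n \<Rightarrow> real" where
  "lattice_kernel S t = (\<Prod>i\<in>UNIV. (cos (pi * (t $ i - of_bool (i \<in> S)) / 2))\<^sup>2)"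

lemma lattice_kernel_nonneg: "0 \<le> lattice_kernel S t"
  by (simp add: lattice_kernel_def prod_nonneg)

lemma cos_squared_le_1: "(cos (x::real))\<^sup>2 \<le> 1"
  using sin_cos_squared_add[of x] zero_le_power2[of "sin x"] by linarith

lemma lattice_kernel_le_1: "lattice_kernel S t \<le> 1"
  unfolding lattice_kernel_def by (intro prod_le_1) (auto simp: cos_squared_le_1)

lemma continuous_on_lattice_kernel: "continuous_on A (lattice_kernel S)"
  unfolding lattice_kernel_def by (intro continuous_intros) auto

lemma lattice_kernel_eq_1:
  assumes "lattice_kernel S t = 1"
  obtains m :: int where "t $ i = of_bool (i \<in> S) + 2 * m"
proof -
  let ?c = "\<lambda>i. (cos (pi * (t $ i - of_bool (i \<in> S)) / 2))\<^sup>2"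
  have "1 = ?c i * (\<Prod>j\<in>UNIV - {i}. ?c j)"
    using assms unfolding lattice_kernel_def by (subst (asm) prod.remove[of UNIV i]) auto
  also have "\<dots> \<le> ?c i * 1"
    by (intro mult_left_mono prod_le_1) (auto simp: cos_squared_le_1)
  finally have "?c i = 1" using cos_squared_le_1 by (simp add: antisym)
  then have "sin (pi * (t $ i - of_bool (i \<in> S)) / 2) = 0"
    using sin_cos_squared_add[of "pi * (t $ i - of_bool (i \<in> S)) / 2"] by simp
  then obtain m :: int where "pi * (t $ i - of_bool (i \<in> S)) / 2 = m * pi"
    by (auto simp: sin_zero_iff_int2)
  then have "pi * (t $ i - of_bool (i \<in> S) - 2 * m) = 0" by (simp add: algebra_simps)
  then have "t $ i = of_bool (i \<in> S) + 2 * m" by simp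
  then show thesis by (rule that)
qed

text \<open>
  Four odd coordinates already give squared norm 4, and a nonzero even coordinate has absolute value
  at least 2. This is where minimum distance 4 enters.
\<close>
lemma lattice_kernel_eq_1_norm:
  fixes t :: "real ^ 'n"
  assumes peak: "lattice_kernel S t = 1" and S: "S = {} \<and> t \<noteq> 0 \<or> 4 \<le> card S"
  shows "2 \<le> norm t"
  using S
proof
  assume "S = {} \<and> t \<noteq> 0"
  then obtain i where i: "t $ i \<noteq> 0" and "S = {}" by (auto simp: vec_eq_iff)
  moreover obtain m :: int where "t $ i = of_bool (i \<in> S) + 2 * m"
    using lattice_kernel_eq_1[OF peak] .
  ultimately have "t $ i = 2 * m" "m \<noteq> 0" by auto
  then have "2 \<le> \<bar>t $ i\<bar>" by (simp add: abs_mult)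
  then show ?thesis using component_le_norm_cart[of t i] by linarith
next
  assume "4 \<le> card S"
  have "1 \<le> (t $ i)\<^sup>2" if "i \<in> S" for i
  proof -
    obtain m :: int where "t $ i = of_bool (i \<in> S) + 2 * m"
      using lattice_kernel_eq_1[OF peak] .
    then have "t $ i = of_int (1 + 2 * m)" using that by simp
    moreover have "1 \<le> \<bar>1 + 2 * m\<bar>" by arith
    then have "1 \<le> (1 + 2 * m)\<^sup>2" using abs_le_square_iff[of 1 "1 + 2 * m"] by simp
    ultimately show ?thesis by (metis of_int_1 of_int_le_iff of_int_power)
  qed
  then have "real (card S) \<le> (\<Sum>i\<in>S. (t $ i)\<^sup>2)" using sum_mono[of S "\<lambda>_. 1" "\<lambda>i. (t $ i)\<^sup>2"] by simp
  also have "\<dots> \<le> (\<Sum>i\<in>UNIV. (t $ i)\<^sup>2)" by (intro sum_mono2) auto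
  also have "\<dots> = (norm t)\<^sup>2" by (simp add: norm_vec_def L2_set_def sum_nonneg)
  finally have "2\<^sup>2 \<le> (norm t)\<^sup>2" using \<open>4 \<le> card S\<close> by simp
  then show ?thesis by (rule power2_le_imp_le) simp
qed

section \<open>The dual side: expansion into characters\<close>

text \<open>
  Shifting the argument by 1, a half period of the squared cosine, changes only the signs of the
  Fourier coefficients. These signs produce the characters of \<open>(\<int>/2)\<^sup>n\<close> in the product over all
  coordinates.
\<close>
lemma cos_power_expansion:
  "complex_of_real (cos (pi * (t - of_bool b) / 2) ^ (2 * N)) =
    (\<Sum>k\<le>2 * N. of_nat ((2 * N) choose k) / 4 ^ N * (if b then (- 1) ^ (k + N) else 1) *
       exp (\<i> * of_real (pi * (real k - real N) * t)))"
proof -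
  define z where "z = \<i> * of_real (pi * (t - of_bool b) / 2)"
  have "complex_of_real (cos (pi * (t - of_bool b) / 2) ^ (2 * N)) = ((exp z + exp (- z)) / 2) ^ (2 * N)"
    by (simp only: of_real_power cos_of_real [symmetric] cos_exp_eq z_def)
  also have "\<dots> = (exp z + exp (- z)) ^ (2 * N) / 4 ^ N"
    by (simp add: power_divide power_mult)
  also have "\<dots> = (\<Sum>k\<le>2 * N. of_nat ((2 * N) choose k) / 4 ^ N * (exp z ^ k * exp (- z) ^ (2 * N - k)))"
    by (simp add: binomial_ring sum_divide_distrib mult_ac)
  also have "\<dots> = (\<Sum>k\<le>2 * N. of_nat ((2 * N) choose k) / 4 ^ N * (if b then (- 1) ^ (k + N) else 1) *
       exp (\<i> * of_real (pi * (real k - real N) * t)))"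
  proof (rule sum.cong[OF refl])
    fix k assume "k \<in> {..2 * N}"
    then have k: "k \<le> 2 * N" by simp
    have "exp z ^ k * exp (- z) ^ (2 * N - k) = exp (of_nat k * z + of_nat (2 * N - k) * (- z))"
      by (simp only: exp_of_nat_mult exp_add)
    also have "of_nat k * z + of_nat (2 * N - k) * (- z) = 2 * (of_nat k - of_nat N) * z"
      using k by (simp add: of_nat_diff algebra_simps)
    also have "\<dots> = \<i> * of_real (pi * (real k - real N) * t)
        + (if b then of_nat k * (- (\<i> * pi)) + of_nat N * (\<i> * pi) else 0)"
      by (simp add: z_def field_simps)
    also have "exp \<dots> = exp (\<i> * of_real (pi * (real k - real N) * t)) *
        (if b then exp (- (\<i> * pi)) ^ k * exp (\<i> * pi) ^ N else 1)"
      by (cases b) (simp_all only: exp_add exp_of_nat_mult if_True if_False exp_zero mult_1_right add_0_right)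
    also have "exp (- (\<i> * pi)) ^ k * exp (\<i> * pi) ^ N = (- 1) ^ (k + N)"
      by (simp add: exp_minus power_add)
    finally show "of_nat ((2 * N) choose k) / 4 ^ N * (exp z ^ k * exp (- z) ^ (2 * N - k))
      = of_nat ((2 * N) choose k) / 4 ^ N * (if b then (- 1) ^ (k + N) else 1) *
       exp (\<i> * of_real (pi * (real k - real N) * t))" by (simp add: mult_ac)
  qed
  finally show ?thesis .
qed

text \<open>
  The exponential is written in the form of the Fourier kernel at the half-integer frequency
  \<open>(N - \<kappa>) / 2\<close>, so that integration against \<open>g\<close> turns it into a value of \<open>fourier g\<close>.
\<close>
lemma lattice_kernel_expansion:
  fixes t :: "real ^ 'n"
  shows "complex_of_real (lattice_kernel S t ^ N) =
    (\<Sum>\<kappa>\<in>PiE UNIV (\<lambda>_. {..2 * N}).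
       of_real ((\<Prod>i\<in>UNIV. real ((2 * N) choose \<kappa> i) / 4 ^ N) * (\<Prod>i\<in>S. (- 1) ^ (\<kappa> i + N))) *
       exp (- (2 * complex_of_real pi * \<i> * complex_of_real (t \<bullet> (\<chi> i. (real N - real (\<kappa> i)) / 2)))))"
proof -
  have "complex_of_real (lattice_kernel S t ^ N)
      = (\<Prod>i\<in>UNIV. complex_of_real (cos (pi * (t $ i - of_bool (i \<in> S)) / 2) ^ (2 * N)))"
    by (simp add: lattice_kernel_def power_mult flip: prod_power_distrib)
  also have "\<dots> = (\<Sum>\<kappa>\<in>PiE UNIV (\<lambda>_. {..2 * N}). \<Prod>i\<in>UNIV. 
      of_nat ((2 * N) choose \<kappa> i) / 4 ^ N * (if i \<in> S then (- 1) ^ (\<kappa> i + N) else 1) *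
       exp (\<i> * of_real (pi * (real (\<kappa> i) - real N) * t $ i)))"
    unfolding cos_power_expansion by (rule prod_sum_PiE) auto
  also have "\<dots> = (\<Sum>\<kappa>\<in>PiE UNIV (\<lambda>_. {..2 * N}).
       of_real ((\<Prod>i\<in>UNIV. real ((2 * N) choose \<kappa> i) / 4 ^ N) * (\<Prod>i\<in>S. (- 1) ^ (\<kappa> i + N))) *
       exp (- (2 * complex_of_real pi * \<i> * complex_of_real (t \<bullet> (\<chi> i. (real N - real (\<kappa> i)) / 2)))))"
  proof (rule sum.cong[OF refl])
    fix \<kappa> :: "'n \<Rightarrow> nat"
    have "(\<Prod>i\<in>UNIV. if i \<in> S then (- 1) ^ (\<kappa> i + N) else 1) = (\<Prod>i\<in>S. (- 1 :: complex) ^ (\<kappa> i + N))"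
      by (simp add: prod.If_cases)
    moreover have "(\<Prod>i\<in>UNIV. exp (\<i> * complex_of_real (pi * (real (\<kappa> i) - real N) * t $ i)))
       = exp (- (2 * complex_of_real pi * \<i> * complex_of_real (t \<bullet> (\<chi> i. (real N - real (\<kappa> i)) / 2))))"
    proof -
      have "(\<Sum>i\<in>UNIV. \<i> * complex_of_real (pi * (real (\<kappa> i) - real N) * t $ i))
        = - (2 * complex_of_real pi * \<i> * complex_of_real (t \<bullet> (\<chi> i. (real N - real (\<kappa> i)) / 2)))"
        unfolding inner_vec_def
        by (simp add: sum_distrib_left flip: sum_negf) (simp add: field_simps)
      then show ?thesis by (simp flip: exp_sum)
    qed
    ultimately show "(\<Prod>i\<in>UNIV. 
      of_nat ((2 * N) choose \<kappa> i) / 4 ^ N * (if i \<in> S then (- 1) ^ (\<kappa> i + N) else 1) *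
       exp (\<i> * of_real (pi * (real (\<kappa> i) - real N) * t $ i))) = 
       of_real ((\<Prod>i\<in>UNIV. real ((2 * N) choose \<kappa> i) / 4 ^ N) * (\<Prod>i\<in>S. (- 1) ^ (\<kappa> i + N))) *
       exp (- (2 * complex_of_real pi * \<i> * complex_of_real (t \<bullet> (\<chi> i. (real N - real (\<kappa> i)) / 2))))"
      unfolding prod.distrib by simp
  qed
  finally show ?thesis .
qed

lemma integrable_times_lattice_kernel:
  fixes g :: "real ^ 'n \<Rightarrow> real"
  assumes "integrable lborel g"
  shows "integrable lborel (\<lambda>x. g x * lattice_kernel S x ^ N)"
proof (rule Bochner_Integration.integrable_bound[OF assms])
  show "(\<lambda>x. g x * lattice_kernel S x ^ N) \<in> borel_measurable lborel"
    using borel_measurable_integrable[OF assms]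
      borel_measurable_continuous_onI[OF continuous_on_lattice_kernel[of UNIV S]] by measurable
  have "\<bar>lattice_kernel S x ^ N\<bar> \<le> 1" for x :: "real ^ 'n"
    using power_le_one[OF lattice_kernel_nonneg lattice_kernel_le_1, of S x N] lattice_kernel_nonneg[of S x]
    by simp
  then show "AE x in lborel. norm (g x * lattice_kernel S x ^ N) \<le> norm (g x)"
    by (auto simp: abs_mult intro!: mult_left_le)
qed

text \<open>
  The finite form of the dual side of Poisson summation. After exchanging sums, the coefficient of
  each value of \<open>fourier g\<close> is a product of binomial coefficients times a value of the transform of
  \<open>w\<close>, taken at a sign vector \<open>\<sigma>\<close>; all these terms are nonnegative and only the one of frequency 0 is
  kept.
\<close>
lemma integral_combination_ge:
  fixes g :: "real ^ 'n::finite \<Rightarrow> real" and w :: "'n set \<Rightarrow> real"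
  assumes g: "integrable lborel g"
    and fourier_nonneg: "\<And>y. fourier g y \<in> \<real>\<^sub>\<ge>\<^sub>0"
    and transform_nonneg: "\<And>\<sigma>. (\<And>i. \<sigma> i = 1 \<or> \<sigma> i = - 1) \<Longrightarrow> 0 \<le> (\<Sum>S\<in>UNIV. w S * (\<Prod>i\<in>S. \<sigma> i))"
  shows "central_mean N ^ CARD('n) * (\<Sum>S\<in>UNIV. w S) * Re (fourier g 0)
    \<le> (\<Sum>S\<in>UNIV. w S * (\<integral>x. g x * lattice_kernel S x ^ N \<partial>lborel))"
proof -
  define K where "K = PiE (UNIV :: 'n set) (\<lambda>_. {..2 * N})"
  define A where "A \<kappa> = (\<Prod>i\<in>UNIV. real ((2 * N) choose \<kappa> i) / 4 ^ N)" for \<kappa> :: "'n \<Rightarrow> nat"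
  define \<phi> where "\<phi> \<kappa> S = (\<Prod>i\<in>S. (- 1 :: real) ^ (\<kappa> i + N))" for \<kappa> and S :: "'n set"
  define y :: "('n \<Rightarrow> nat) \<Rightarrow> real ^ 'n" where "y \<kappa> = (\<chi> i. (real N - real (\<kappa> i)) / 2)" for \<kappa>
  let ?e = "\<lambda>y x. exp (- (2 * complex_of_real pi * \<i> * complex_of_real (x \<bullet> y)))"
  have finK: "finite K" by (simp add: K_def finite_PiE)
  have expand: "(\<integral>x. g x * lattice_kernel S x ^ N \<partial>lborel) = (\<Sum>\<kappa>\<in>K. A \<kappa> * \<phi> \<kappa> S * Re (fourier g (y \<kappa>)))" for S
  proof -
    have int: "integrable lborel (\<lambda>x. complex_of_real (g x) * ?e y x)" for y
    proof (rule Bochner_Integration.integrable_bound[OF g])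
      show "(\<lambda>x. complex_of_real (g x) * ?e y x) \<in> borel_measurable lborel"
        using borel_measurable_integrable[OF g] by measurable
      show "AE x in lborel. norm (complex_of_real (g x) * ?e y x) \<le> norm (g x)"
        by (simp add: norm_mult)
    qed
    have "complex_of_real (\<integral>x. g x * lattice_kernel S x ^ N \<partial>lborel)
      = (\<integral>x. complex_of_real (g x * lattice_kernel S x ^ N) \<partial>lborel)"
      by (rule integral_complex_of_real [symmetric])
    also have "\<dots> = (\<integral>x. (\<Sum>\<kappa>\<in>K. of_real (A \<kappa> * \<phi> \<kappa> S) * (complex_of_real (g x) * ?e (y \<kappa>) x)) \<partial>lborel)"
      by (simp only: of_real_mult[of "g _"] lattice_kernel_expansion sum_distrib_left K_def A_def \<phi>_def y_def)
        (simp add: mult_ac)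
    also have "\<dots> = (\<Sum>\<kappa>\<in>K. of_real (A \<kappa> * \<phi> \<kappa> S) * fourier g (y \<kappa>))"
      unfolding fourier_def by (subst Bochner_Integration.integral_sum) (simp_all add: int)
    finally have "(\<integral>x. g x * lattice_kernel S x ^ N \<partial>lborel)
        = Re (\<Sum>\<kappa>\<in>K. of_real (A \<kappa> * \<phi> \<kappa> S) * fourier g (y \<kappa>))"
      by (metis Re_complex_of_real)
    then show ?thesis by (simp add: Re_sum)
  qed
  have sum_eq: "(\<Sum>S\<in>UNIV. w S * (\<integral>x. g x * lattice_kernel S x ^ N \<partial>lborel))
      = (\<Sum>\<kappa>\<in>K. A \<kappa> * (\<Sum>S\<in>UNIV. w S * \<phi> \<kappa> S) * Re (fourier g (y \<kappa>)))"
    unfolding expand sum_distrib_left sum_distrib_right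
    by (subst sum.swap) (simp add: mult_ac)
  have nonneg: "0 \<le> A \<kappa> * (\<Sum>S\<in>UNIV. w S * \<phi> \<kappa> S) * Re (fourier g (y \<kappa>))" for \<kappa>
  proof (intro mult_nonneg_nonneg)
    show "0 \<le> A \<kappa>" by (simp add: A_def prod_nonneg)
    show "0 \<le> (\<Sum>S\<in>UNIV. w S * \<phi> \<kappa> S)"
      unfolding \<phi>_def by (rule transform_nonneg) (auto simp: minus_one_power_iff)
    show "0 \<le> Re (fourier g (y \<kappa>))"
      using fourier_nonneg by (simp add: complex_nonneg_Reals_iff)
  qed
  \<comment> \<open>The exponent vector constantly equal to \<open>N\<close> is the one of frequency 0.\<close>
  have "A (\<lambda>_. N) = central_mean N ^ CARD('n)" "y (\<lambda>_. N) = 0" "\<phi> (\<lambda>_. N) S = 1" for S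
    by (simp_all add: A_def central_mean_def y_def \<phi>_def vec_eq_iff)
  then have "central_mean N ^ CARD('n) * (\<Sum>S\<in>UNIV. w S) * Re (fourier g 0)
      = A (\<lambda>_. N) * (\<Sum>S\<in>UNIV. w S * \<phi> (\<lambda>_. N) S) * Re (fourier g (y (\<lambda>_. N)))"
    by simp
  also have "\<dots> \<le> (\<Sum>\<kappa>\<in>K. A \<kappa> * (\<Sum>S\<in>UNIV. w S * \<phi> \<kappa> S) * Re (fourier g (y \<kappa>)))"
    by (rule member_le_sum) (use nonneg finK in \<open>auto simp: K_def PiE_iff\<close>)
  finally show ?thesis by (simp only: sum_eq)
qed

section \<open>The primal side: concentration of the kernels\<close>

lemma has_bochner_integral_box_kernel:
  fixes a b :: int and S :: "'n::finite set"
  assumes "a \<le> b"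
  shows "has_bochner_integral lborel
    (\<lambda>x::real^'n. \<Prod>i\<in>UNIV. indicator {real_of_int a..b} (x $ i) * cos (pi * (x $ i - of_bool (i \<in> S)) / 2) ^ (2 * N))
    (((b - a) * central_mean N) ^ CARD('n))"
proof -
  have "has_bochner_integral lborel
      (\<lambda>t. indicator {real_of_int a..b} t * cos (pi * (t - of_bool (i \<in> S)) / 2) ^ (2 * N))
      ((b - a) * central_mean N)" for i
  proof -
    let ?f = "\<lambda>t. cos (pi * (t - of_bool (i \<in> S)) / 2) ^ (2 * N)"
    have "set_integrable lborel {real_of_int a..b} ?f"
      by (rule borel_integrable_atLeastAtMost') (intro continuous_intros, auto)
    moreover have "(?f has_integral (b - a) * central_mean N) {real_of_int a..b}"
      using integral_cos_power[OF assms, of "of_bool (i \<in> S)" N] by simp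
    ultimately show ?thesis
      using set_borel_integral_eq_integral(2)[of "{real_of_int a..b}" ?f]
      by (auto simp: has_bochner_integral_iff set_integrable_def set_lebesgue_integral_def integral_unique)
  qed
  from has_bochner_integral_prod_components[OF this]
  show ?thesis by simp
qed

text \<open>
  Points of the ball where \<open>g\<close> is at least \<open>\<epsilon>\<close> form a compact set. For nonempty \<open>S\<close> the kernel has no peak
  in it, since \<open>g\<close> is nonpositive at all peaks; so the kernel is bounded there by some \<open>q < 1\<close> and its
  powers decay geometrically. For \<open>S = {}\<close> the only possible peak in this set is the origin; the points near it
  are split off, where \<open>g\<close> is at most \<open>g 0 + \<epsilon>\<close> and the kernel has at most the mass of one period
  cell. The first summand, with the mass of the cube of side 4, accounts for the points where \<open>g\<close> is at most \<open>\<epsilon>\<close>.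
\<close>
lemma integral_lattice_kernel_le:
  fixes g :: "real ^ 'n::finite \<Rightarrow> real" and S :: "'n set"
  assumes cont: "continuous_on UNIV g" and int: "integrable lborel g"
    and nonpos: "\<And>x. 2 \<le> norm x \<Longrightarrow> g x \<le> 0" and g0: "0 \<le> g 0"
    and S: "S = {} \<or> 4 \<le> card S" and \<epsilon>: "0 < \<epsilon>"
  shows "\<exists>q C. 0 \<le> q \<and> q < 1 \<and> 0 \<le> C \<and> (\<forall>N. (\<integral>x. g x * lattice_kernel S x ^ N \<partial>lborel) \<le>
       \<epsilon> * (4 * central_mean N) ^ CARD('n) + C * q ^ N
       + (if S = {} then (g 0 + \<epsilon>) * (2 * central_mean N) ^ CARD('n) else 0))"
proof -
  have cont': "continuous_on A g" for A using cont continuous_on_subset by blast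
  \<comment> \<open>The part of the ball on which no bound by \<open>\<epsilon>\<close> or, near the origin, by \<open>g 0 + \<epsilon>\<close> is available.\<close>
  define P where "P = {t \<in> cball 0 2. \<epsilon> \<le> g t \<and> (S = {} \<longrightarrow> g 0 + \<epsilon> \<le> g t \<or> (\<exists>i. 1 \<le> \<bar>t $ i\<bar>))}"
  define D where "D = {t. \<epsilon> \<le> g t} \<inter>
      (if S = {} then {t. g 0 + \<epsilon> \<le> g t} \<union> (\<Union>i. {t. 1 \<le> \<bar>t $ i\<bar>}) else UNIV)"
  have "closed D" unfolding D_def
    by (auto intro!: closed_Int closed_Un closed_UN closed_Collect_le continuous_intros cont')
  moreover have "P = cball 0 2 \<inter> D"
    by (auto simp: P_def D_def)
  ultimately have "compact P"
    by (simp add: compact_Int_closed)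
  have below: "lattice_kernel S t < 1" if "t \<in> P" for t
  proof (rule ccontr)
    assume "\<not> lattice_kernel S t < 1"
    then have "lattice_kernel S t = 1" using lattice_kernel_le_1[of S t] by linarith
    moreover have "S = {} \<and> t \<noteq> 0 \<or> 4 \<le> card S" using S \<open>t \<in> P\<close> \<epsilon> by (auto simp: P_def)
    ultimately have "2 \<le> norm t" by (rule lattice_kernel_eq_1_norm)
    then show False using nonpos[of t] \<open>t \<in> P\<close> \<epsilon> by (simp add: P_def)
  qed
  obtain q where q: "0 \<le> q" "q < 1" "\<And>t. t \<in> P \<Longrightarrow> lattice_kernel S t \<le> q"
  proof (cases "P = {}")
    case True
    then show thesis using that[of 0] by auto
  next
    case False
    then obtain s where "s \<in> P" "\<And>t. t \<in> P \<Longrightarrow> lattice_kernel S t \<le> lattice_kernel S s"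
      using continuous_attains_sup[OF \<open>compact P\<close> False continuous_on_lattice_kernel] by blast
    then show thesis using that[of "lattice_kernel S s"] below lattice_kernel_nonneg by blast
  qed
  have "\<exists>s\<in>cball 0 2. \<forall>t\<in>cball 0 2. g t \<le> g s"
    by (rule continuous_attains_sup) (auto intro: cont')
  then obtain s where s: "\<forall>t\<in>cball 0 2. g t \<le> g s" by blast
  define M where "M = g s"
  have M: "g t \<le> M" if "norm t \<le> 2" for t using s that by (simp add: M_def)
  have M0: "0 \<le> M" using g0 order_trans[OF g0 M[of 0]] by simp
  \<comment> \<open>The kernel power cut off to a cube, kept as a product so that its integral factorizes.\<close>
  define B where "B a b N t = (\<Prod>i\<in>UNIV. indicator {real_of_int a..b} (t $ i)
      * cos (pi * (t $ i - of_bool (i \<in> S)) / 2) ^ (2 * N))" for a b :: int and N and t :: "real ^ 'n"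
  have B_eq: "B a b N t = lattice_kernel S t ^ N" if "\<And>i. a \<le> t $ i \<and> t $ i \<le> b" for a b N t
    using that by (simp add: B_def lattice_kernel_def power_mult flip: prod_power_distrib)
  have B_nonneg: "0 \<le> B a b N t" for a b N t
    by (simp add: B_def prod_nonneg)
  have B_int: "has_bochner_integral lborel (B (- 2) 2 N) ((4 * central_mean N) ^ CARD('n))"
    "has_bochner_integral lborel (B (- 1) 1 N) ((2 * central_mean N) ^ CARD('n))" for N
    using has_bochner_integral_box_kernel[of "- 2" 2 S N] has_bochner_integral_box_kernel[of "- 1" 1 S N]
    by (simp_all add: B_def[abs_def])
  have pointwise: "g t * lattice_kernel S t ^ N \<le> \<epsilon> * B (- 2) 2 N t + M * q ^ N * indicator (cball 0 2) t
      + (if S = {} then (g 0 + \<epsilon>) * B (- 1) 1 N t else 0)" for N t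
  proof -
    let ?K = "lattice_kernel S t ^ N"
    have nonneg: "0 \<le> \<epsilon> * B (- 2) 2 N t" "0 \<le> M * q ^ N * indicator (cball 0 2) t"
      "0 \<le> (if S = {} then (g 0 + \<epsilon>) * B (- 1) 1 N t else 0)" "0 \<le> ?K"
      using \<epsilon> M0 q(1) g0 B_nonneg lattice_kernel_nonneg[of S t] by auto
    have "2 < norm t \<or> norm t \<le> 2 \<and> g t \<le> \<epsilon> \<or> t \<in> P
      \<or> norm t \<le> 2 \<and> S = {} \<and> g t \<le> g 0 + \<epsilon> \<and> (\<forall>i. \<bar>t $ i\<bar> < 1)"
      by (auto simp: P_def not_le not_less)
    then consider "2 < norm t" | "norm t \<le> 2" "g t \<le> \<epsilon>" | "t \<in> P"
      | "norm t \<le> 2" "S = {}" "g t \<le> g 0 + \<epsilon>" "\<And>i. \<bar>t $ i\<bar> < 1"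
      by blast
    then show ?thesis
    proof cases
      case 1
      then have "g t * ?K \<le> 0" using nonpos[of t] nonneg(4) by (simp add: mult_nonpos_nonneg)
      then show ?thesis using nonneg by linarith
    next
      case 2
      have "\<bar>t $ i\<bar> \<le> 2" for i using component_le_norm_cart[of t i] 2 by linarith
      then have "B (- 2) 2 N t = ?K" by (intro B_eq) (auto simp: abs_le_iff minus_le_iff)
      then have "g t * ?K \<le> \<epsilon> * B (- 2) 2 N t" using 2 nonneg by (simp add: mult_right_mono)
      then show ?thesis using nonneg by linarith
    next
      case 3
      then have t: "t \<in> cball 0 2" by (simp add: P_def)
      have "g t * ?K \<le> M * q ^ N"
        using t M[of t] M0 q(3)[OF 3] nonneg lattice_kernel_nonneg[of S t] by (intro mult_mono power_mono) auto
      then show ?thesis using nonneg t by simp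
    next
      case 4
      then have "B (- 1) 1 N t = ?K" by (intro B_eq) (auto simp: abs_less_iff less_imp_le)
      then have "g t * ?K \<le> (g 0 + \<epsilon>) * B (- 1) 1 N t" using 4 nonneg by (simp add: mult_right_mono)
      then show ?thesis using nonneg 4 by simp
    qed
  qed
  define V where "V = measure lborel (cball 0 2 :: (real ^ 'n) set)"
  have ball: "has_bochner_integral lborel (indicator (cball 0 2 :: (real ^ 'n) set)) V"
    unfolding V_def using emeasure_lborel_cball_finite[of "0 :: real ^ 'n" 2]
    by (intro has_bochner_integral_real_indicator) simp_all
  have "(\<integral>x. g x * lattice_kernel S x ^ N \<partial>lborel) \<le>
       \<epsilon> * (4 * central_mean N) ^ CARD('n) + M * V * q ^ N
       + (if S = {} then (g 0 + \<epsilon>) * (2 * central_mean N) ^ CARD('n) else 0)" for N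
  proof -
    have "has_bochner_integral lborel (\<lambda>t. if S = {} then (g 0 + \<epsilon>) * B (- 1) 1 N t else 0)
        (if S = {} then (g 0 + \<epsilon>) * (2 * central_mean N) ^ CARD('n) else 0)"
      by (cases "S = {}") (simp_all only: simp_thms if_True if_False has_bochner_integral_mult_right B_int
        has_bochner_integral_zero)
    then have rhs: "has_bochner_integral lborel (\<lambda>t. \<epsilon> * B (- 2) 2 N t + M * q ^ N * indicator (cball 0 2) t
      + (if S = {} then (g 0 + \<epsilon>) * B (- 1) 1 N t else 0))
      (\<epsilon> * (4 * central_mean N) ^ CARD('n) + M * q ^ N * V
       + (if S = {} then (g 0 + \<epsilon>) * (2 * central_mean N) ^ CARD('n) else 0))"
      by (intro has_bochner_integral_add has_bochner_integral_mult_right B_int ball)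
    have "(\<integral>x. g x * lattice_kernel S x ^ N \<partial>lborel) \<le>
        (\<integral>t. \<epsilon> * B (- 2) 2 N t + M * q ^ N * indicator (cball 0 2) t
          + (if S = {} then (g 0 + \<epsilon>) * B (- 1) 1 N t else 0) \<partial>lborel)"
      by (intro integral_mono integrable_times_lattice_kernel int pointwise integrable.intros[OF rhs])
    also note has_bochner_integral_integral_eq[OF rhs]
    also have "M * q ^ N * V = M * V * q ^ N" by simp
    finally show ?thesis .
  qed
  moreover have "0 \<le> M * V" using M0 by (simp add: V_def)
  ultimately show ?thesis using q by blast
qed

section \<open>Weak duality for weights modulo 2\<close>

text \<open>
  Both estimates are divided by the common mass \<open>central_mean N ^ CARD('n)\<close>; then \<open>N\<close> tends to infinity,
  which removes the geometric error, and finally \<open>\<epsilon>\<close> tends to 0. The sum over \<open>S\<close> in the last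
  hypothesis is the transform of \<open>w\<close> at the character given by the signs \<open>\<sigma>\<close>.
\<close>
lemma weighted_lattice_bound:
  fixes g :: "real ^ 'n::finite \<Rightarrow> real" and w :: "'n set \<Rightarrow> real"
  assumes cont: "continuous_on UNIV g" and int: "integrable lborel g"
    and nonpos: "\<And>x. 2 \<le> norm x \<Longrightarrow> g x \<le> 0" and g0: "0 \<le> g 0"
    and fourier_nonneg: "\<And>y. fourier g y \<in> \<real>\<^sub>\<ge>\<^sub>0"
    and w_nonneg: "\<And>S. 0 \<le> w S" and w_empty: "w {} = 1"
    and w_support: "\<And>S. w S \<noteq> 0 \<Longrightarrow> S = {} \<or> 4 \<le> card S"
    and transform_nonneg: "\<And>\<sigma>. (\<And>i. \<sigma> i = 1 \<or> \<sigma> i = - 1) \<Longrightarrow> 0 \<le> (\<Sum>S\<in>UNIV. w S * (\<Prod>i\<in>S. \<sigma> i))"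
  shows "(\<Sum>S\<in>UNIV. w S) * Re (fourier g 0) \<le> 2 ^ CARD('n) * g 0"
proof -
  let ?n = "CARD('n)"
  define W where "W = (\<Sum>S\<in>UNIV. w S)"
  have W0: "0 \<le> W" by (simp add: W_def sum_nonneg w_nonneg)
  have approx: "W * Re (fourier g 0) \<le> 2 ^ ?n * g 0 + \<epsilon> * (W * 4 ^ ?n + 2 ^ ?n)" if \<epsilon>: "0 < \<epsilon>" for \<epsilon>
  proof -
    define P where "P S q C \<longleftrightarrow> 0 \<le> q \<and> q < 1 \<and> 0 \<le> C \<and> (\<forall>N. w S * (\<integral>x. g x * lattice_kernel S x ^ N \<partial>lborel) \<le>
       w S * (\<epsilon> * (4 * central_mean N) ^ ?n + C * q ^ N
       + (if S = {} then (g 0 + \<epsilon>) * (2 * central_mean N) ^ ?n else 0)))" for S and q C :: real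
    have "\<exists>q C. P S q C" for S
    proof (cases "w S = 0")
      case True
      then have "P S 0 0" by (simp add: P_def)
      then show ?thesis by blast
    next
      case False
      have "\<exists>q C. 0 \<le> q \<and> q < 1 \<and> 0 \<le> C \<and> (\<forall>N. (\<integral>x. g x * lattice_kernel S x ^ N \<partial>lborel) \<le>
           \<epsilon> * (4 * central_mean N) ^ ?n + C * q ^ N
           + (if S = {} then (g 0 + \<epsilon>) * (2 * central_mean N) ^ ?n else 0))"
        by (rule integral_lattice_kernel_le[OF cont int nonpos g0 w_support[OF False] \<epsilon>])
      then obtain q C where "P S q C" unfolding P_def by (blast intro: mult_left_mono w_nonneg)
      then show ?thesis by blast
    qed
    then obtain q where "\<forall>S. \<exists>C. P S (q S) C" by (rule choice[OF allI, THEN exE])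
    then obtain C where P: "\<forall>S. P S (q S) (C S)" by (rule choice[THEN exE])
    then have q: "\<And>S. 0 \<le> q S" "\<And>S. q S < 1" and C: "\<And>S. 0 \<le> C S"
      unfolding P_def by blast+
    have bound: "w S * (\<integral>x. g x * lattice_kernel S x ^ N \<partial>lborel) \<le>
       w S * (\<epsilon> * (4 * central_mean N) ^ ?n + C S * q S ^ N
       + (if S = {} then (g 0 + \<epsilon>) * (2 * central_mean N) ^ ?n else 0))" for S N
      using P unfolding P_def by blast
    define err where "err N = (\<Sum>S\<in>UNIV. w S * C S * (q S ^ N * (2 * real N) ^ ?n))" for N
    have step: "W * Re (fourier g 0) \<le> W * \<epsilon> * 4 ^ ?n + (g 0 + \<epsilon>) * 2 ^ ?n + err N" if "N > 0" for N
    proof -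
      let ?m = "central_mean N ^ ?n"
      have m: "0 < ?m" by (simp add: central_mean_pos)
      have "?m * W * Re (fourier g 0) \<le> (\<Sum>S\<in>UNIV. w S * (\<integral>x. g x * lattice_kernel S x ^ N \<partial>lborel))"
        unfolding W_def by (rule integral_combination_ge[OF int fourier_nonneg transform_nonneg])
      also have "\<dots> \<le> (\<Sum>S\<in>UNIV. w S * (\<epsilon> * (4 * central_mean N) ^ ?n + C S * q S ^ N
       + (if S = {} then (g 0 + \<epsilon>) * (2 * central_mean N) ^ ?n else 0)))"
        by (intro sum_mono bound)
      also have "\<dots> = W * \<epsilon> * 4 ^ ?n * ?m + (\<Sum>S\<in>UNIV. w S * C S * q S ^ N) + (g 0 + \<epsilon>) * 2 ^ ?n * ?m"
      proof -
        have "(\<Sum>S\<in>UNIV. w S * (if S = {} then c else 0)) = c" for c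
          by (simp add: if_distrib w_empty sum.delta cong: if_cong)
        then show ?thesis
          by (simp add: distrib_left sum.distrib W_def sum_distrib_left sum_distrib_right power_mult_distrib mult_ac)
      qed
      also have "(\<Sum>S\<in>UNIV. w S * C S * q S ^ N) \<le> err N * ?m"
      proof -
        have "1 \<le> (2 * real N * central_mean N) ^ ?n"
          using central_mean_lower[OF that] that by (intro one_le_power) (simp add: field_simps)
        then have "w S * C S * q S ^ N * 1 \<le> w S * C S * q S ^ N * (2 * real N * central_mean N) ^ ?n" for S
          using w_nonneg[of S] C[of S] q(1)[of S] by (intro mult_left_mono) auto
        then have "(\<Sum>S\<in>UNIV. w S * C S * q S ^ N)
            \<le> (\<Sum>S\<in>UNIV. w S * C S * q S ^ N * (2 * real N * central_mean N) ^ ?n)"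
          by (intro sum_mono) simp
        also have "\<dots> = err N * ?m"
          by (simp add: err_def sum_distrib_left power_mult_distrib mult_ac)
        finally show ?thesis .
      qed
      finally have "?m * (W * Re (fourier g 0)) \<le> ?m * (W * \<epsilon> * 4 ^ ?n + (g 0 + \<epsilon>) * 2 ^ ?n + err N)"
        by (simp add: algebra_simps)
      then show ?thesis using m by (simp only: mult_le_cancel_left_pos)
    qed
    have "err \<longlonglongrightarrow> (\<Sum>S\<in>UNIV. w S * C S * 0)"
      unfolding err_def by (intro tendsto_sum tendsto_mult tendsto_const geometric_beats_power q)
    then have "(\<lambda>N. W * \<epsilon> * 4 ^ ?n + (g 0 + \<epsilon>) * 2 ^ ?n + err N) \<longlonglongrightarrow> W * \<epsilon> * 4 ^ ?n + (g 0 + \<epsilon>) * 2 ^ ?n + 0"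
      by (intro tendsto_add tendsto_const) simp
    then have "W * Re (fourier g 0) \<le> W * \<epsilon> * 4 ^ ?n + (g 0 + \<epsilon>) * 2 ^ ?n + 0"
      by (rule LIMSEQ_le_const) (auto intro!: exI[of _ 1] step)
    then show ?thesis by (simp add: algebra_simps)
  qed
  have "W * Re (fourier g 0) \<le> 2 ^ ?n * g 0"
  proof (rule field_le_epsilon)
    fix e :: real assume "0 < e"
    have pos: "0 < W * 4 ^ ?n + 2 ^ ?n" using W0 by (simp add: add_nonneg_pos)
    show "W * Re (fourier g 0) \<le> 2 ^ ?n * g 0 + e"
      using approx[of "e / (W * 4 ^ ?n + 2 ^ ?n)"] pos \<open>0 < e\<close> by simp
  qed
  then show ?thesis by (simp add: W_def)
qed

lemma integral_dilation:
  fixes F :: "'a::euclidean_space \<Rightarrow> 'b::{banach, second_countable_topology}"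
  assumes "s > 0" and [measurable]: "F \<in> borel_measurable borel"
  shows "(\<integral>x. F x \<partial>lborel) = s ^ DIM('a) *\<^sub>R (\<integral>x. F (s *\<^sub>R x) \<partial>lborel)"
proof -
  have "(\<integral>x. F x \<partial>lborel) = (\<integral>x. F x \<partial>density (distr lborel borel (\<lambda>x. 0 + s *\<^sub>R x)) (\<lambda>_. \<bar>s\<bar> ^ DIM('a)))"
    using assms(1) by (subst lborel_affine[of s 0]) auto
  also have "\<dots> = (\<integral>x. s ^ DIM('a) *\<^sub>R F (s *\<^sub>R x) \<partial>lborel)"
    using assms(1) by (subst integral_density) (auto simp: integral_distr ennreal_power)
  finally show ?thesis by simp
qed

lemma fourier_dilation:
  fixes f :: "real ^ 'n \<Rightarrow> real"
  assumes "s > 0" and [measurable]: "f \<in> borel_measurable borel"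
  shows "fourier f (y /\<^sub>R s) = s ^ CARD('n) *\<^sub>R fourier (\<lambda>x. f (s *\<^sub>R x)) y"
proof -
  have eq: "s *\<^sub>R x \<bullet> (y /\<^sub>R s) = x \<bullet> y" for x :: "real ^ 'n"
    using assms(1) by simp
  have "(\<lambda>x. complex_of_real (f x) * exp (- (2 * complex_of_real pi * \<i> * complex_of_real (x \<bullet> (y /\<^sub>R s)))))
      \<in> borel_measurable borel"
    by measurable
  from integral_dilation[OF assms(1) this] show ?thesis
    by (simp only: fourier_def eq DIM_cart DIM_real mult_1_right)
qed

section \<open>The certificate in dimension 13\<close>

text \<open>
  For weights that depend only on the cardinality, the transform is governed by Krawtchouk polynomials:
  their values are the coefficients of the generating function \<open>(1 - z) ^ j * (1 + z) ^ (n - j)\<close>, which is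
  the product of the linear factors \<open>1 + \<sigma> i * z\<close>.
\<close>
lemma sum_over_subsets_by_card:
  fixes a :: "nat \<Rightarrow> real" and \<sigma> :: "'n::finite \<Rightarrow> real"
  assumes \<sigma>: "\<And>i. \<sigma> i = 1 \<or> \<sigma> i = - 1"
  defines "j \<equiv> card {i. \<sigma> i = - 1}"
  shows "(\<Sum>S\<in>UNIV. a (card S) * (\<Prod>i\<in>S. \<sigma> i)) =
    (\<Sum>k\<le>CARD('n). a k * coeff ([:1, - 1:] ^ j * [:1, 1:] ^ (CARD('n) - j)) k)"
proof -
  define p where "p = (\<Prod>i\<in>UNIV. [:1, \<sigma> i:])"
  have "p = (\<Prod>i\<in>UNIV. [:0, \<sigma> i:] + 1)" by (simp add: p_def one_pCons)
  also have "\<dots> = (\<Sum>S\<in>UNIV. \<Prod>i\<in>S. [:0, \<sigma> i:])" by (subst prod_add) auto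
  also have "\<dots> = (\<Sum>S\<in>UNIV. monom (\<Prod>i\<in>S. \<sigma> i) (card S))"
  proof (rule sum.cong[OF refl])
    fix S :: "'n set"
    show "(\<Prod>i\<in>S. [:0, \<sigma> i:]) = monom (\<Prod>i\<in>S. \<sigma> i) (card S)"
      using finite[of S]
      by (induction S rule: finite_induct) (simp_all add: monom_Suc smult_monom mult_monom one_pCons monom_0)
  qed
  finally have p: "p = (\<Sum>S\<in>UNIV. monom (\<Prod>i\<in>S. \<sigma> i) (card S))" .
  have "p = (\<Prod>i\<in>{i. \<sigma> i = - 1}. [:1, \<sigma> i:]) * (\<Prod>i\<in>-{i. \<sigma> i = - 1}. [:1, \<sigma> i:])"
    unfolding p_def by (subst prod.union_disjoint [symmetric]) (simp_all add: Compl_partition)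
  also have "(\<Prod>i\<in>{i. \<sigma> i = - 1}. [:1, \<sigma> i:]) = [:1, - 1:] ^ j"
    by (simp add: j_def)
  also have "(\<Prod>i\<in>-{i. \<sigma> i = - 1}. [:1, \<sigma> i:]) = (\<Prod>i\<in>-{i. \<sigma> i = - 1}. [:1, 1:])"
    using \<sigma> by (intro prod.cong) auto
  also have "\<dots> = [:1, 1:] ^ (CARD('n) - j)"
    by (simp add: j_def Compl_eq_Diff_UNIV card_Diff_subset)
  finally have "[:1, - 1:] ^ j * [:1, 1:] ^ (CARD('n) - j) = p" ..
  then have "(\<Sum>k\<le>CARD('n). a k * coeff ([:1, - 1:] ^ j * [:1, 1:] ^ (CARD('n) - j)) k)
      = (\<Sum>k\<le>CARD('n). \<Sum>S\<in>UNIV. if card S = k then a k * (\<Prod>i\<in>S. \<sigma> i) else 0)"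
    by (auto simp: p coeff_sum sum_distrib_left intro!: sum.cong)
  also have "\<dots> = (\<Sum>S\<in>UNIV. \<Sum>k\<le>CARD('n). if card S = k then a k * (\<Prod>i\<in>S. \<sigma> i) else 0)"
    by (rule sum.swap)
  also have "\<dots> = (\<Sum>S\<in>UNIV. a (card S) * (\<Prod>i\<in>S. \<sigma> i))"
    by (intro sum.cong) (auto simp: sum.delta' card_mono)
  finally show ?thesis ..
qed

text \<open>
  A vertex of the feasible region of Delsarte's linear program for length 13 and distance 4. Multiplied
  by \<open>13 choose k\<close>, the values are the distance distribution 1, 65, 104, 741/7, 104/7, 13/7 at distances
  0, 4, 6, 8, 10, 12, with sum 2048/7.
\<close>
definition delsarte_weight :: "nat \<Rightarrow> real" where
  "delsarte_weight k =
    (if k = 0 then 1 else if k = 4 then 1 / 11 else if k = 6 then 2 / 33 else if k = 8 then 19 / 231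
     else if k = 10 then 4 / 77 else if k = 12 then 1 / 7 else 0)"

text \<open>
  The transform vanishes outside \<open>j = 0, 6, 7, 13\<close>. The symmetry under \<open>j \<mapsto> 13 - j\<close> reflects that only
  even cardinalities carry weight.
\<close>
lemma krawtchouk_13:
  assumes "j \<le> 13"
  shows "(\<Sum>k\<le>13. delsarte_weight k * coeff ([:1, - 1:] ^ j * [:1, 1:] ^ (13 - j)) k) =
    (if j = 0 \<or> j = 13 then 2048 / 7 else if j = 6 \<or> j = 7 then 512 / 231 else 0)"
proof -
  have "j \<in> {0, 1, 2, 3, 4, 5, 6, 7, 8, 9, 10, 11, 12, 13}" using assms by (simp, presburger)
  moreover have "{..13} = {0, 1, 2, 3, 4, 5, 6, 7, 8, 9, 10, 11, 12, 13 :: nat}"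
    unfolding set_eq_iff atMost_iff insert_iff empty_iff by presburger
  ultimately show ?thesis
    by (elim insertE emptyE)
      (simp_all add: delsarte_weight_def power_numeral_even power_numeral_odd coeff_pCons numeral_eq_Suc)
qed

theorem corollary9p3:
  fixes r :: real
  assumes "r > 0"
  shows "cohn_elkies_bound TYPE(13) r \<ge> ereal (1 / 28) \<and> (1 / 28 :: real) > 0.03571428"
proof
  show "(1 / 28 :: real) > 0.03571428" by simp
  have "1 / 28 \<le> (r / 2) ^ CARD(13) * f 0" if f: "cohn_elkies_feasible r f" for f :: "real ^ 13 \<Rightarrow> real"
  proof -
    define s where "s = r / 2"
    define g where "g = (\<lambda>x. f (s *\<^sub>R x))"
    define w where "w S = delsarte_weight (card S)" for S :: "13 set"
    have s: "0 < s" using assms by (simp add: s_def)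
    have "continuously_differentiable 0 f"
      using f by (simp only: cohn_elkies_feasible_def smooth_def)
    then have cont_f: "continuous_on UNIV f" by simp
    then have cont: "continuous_on UNIV g"
      unfolding g_def by (rule continuous_on_compose2) (auto intro!: continuous_intros)
    have dilation: "fourier f (y /\<^sub>R s) = s ^ 13 *\<^sub>R fourier g y" for y
      using fourier_dilation[OF s borel_measurable_continuous_onI[OF cont_f], of y] by (simp add: g_def)
    have nonneg: "fourier g y \<in> \<real>\<^sub>\<ge>\<^sub>0" for y
    proof -
      have "s ^ 13 *\<^sub>R fourier g y \<in> \<real>\<^sub>\<ge>\<^sub>0"
        using f unfolding cohn_elkies_feasible_def dilation[symmetric] by blast
      then show ?thesis using s by (simp add: complex_nonneg_Reals_iff zero_le_mult_iff not_le)
    qed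
    have at_0: "1 \<le> s ^ 13 * Re (fourier g 0)"
      using f dilation[of 0] by (simp add: cohn_elkies_feasible_def)
    \<comment> \<open>The integral of a non-integrable function is 0 by convention, so a positive value of the
      transform at 0 already forces integrability.\<close>
    have int: "integrable lborel g"
    proof -
      have "Re (fourier g 0) = (\<integral>x. g x \<partial>lborel)" by (simp add: fourier_def)
      moreover have "Re (fourier g 0) \<noteq> 0" using at_0 by auto
      ultimately show ?thesis using not_integrable_integral_eq by metis
    qed
    have sum_w: "(\<Sum>S\<in>UNIV. w S * (\<Prod>i\<in>S. \<sigma> i)) =
        (\<Sum>k\<le>13. delsarte_weight k * coeff ([:1, - 1:] ^ card {i. \<sigma> i = - 1} * [:1, 1:] ^ (13 - card {i. \<sigma> i = - 1})) k)"
      if "\<And>i. \<sigma> i = 1 \<or> \<sigma> i = - 1" for \<sigma> :: "13 \<Rightarrow> real"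
      using sum_over_subsets_by_card[where \<sigma> = \<sigma> and a = delsarte_weight, OF that] by (simp add: w_def)
    have total: "(\<Sum>S\<in>UNIV. w S) = 2048 / 7"
      using sum_w[of "\<lambda>_. 1"] krawtchouk_13[of 0] by simp
    have "(\<Sum>S\<in>UNIV. w S) * Re (fourier g 0) \<le> 2 ^ CARD(13) * g 0"
    proof (rule weighted_lattice_bound[OF cont int _ _ nonneg])
      show "g x \<le> 0" if "2 \<le> norm x" for x
      proof -
        have "r \<le> norm (s *\<^sub>R x)" using that assms by (simp add: s_def)
        then show ?thesis using f by (simp add: cohn_elkies_feasible_def g_def)
      qed
      show "0 \<le> g 0" using f by (simp add: cohn_elkies_feasible_def g_def)
      show "0 \<le> w S" for S by (simp add: w_def delsarte_weight_def)
      show "w {} = 1" by (simp add: w_def delsarte_weight_def)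
      show "S = {} \<or> 4 \<le> card S" if "w S \<noteq> 0" for S
        using that by (auto simp: w_def delsarte_weight_def split: if_splits)
      show "0 \<le> (\<Sum>S\<in>UNIV. w S * (\<Prod>i\<in>S. \<sigma> i))" if "\<And>i. \<sigma> i = 1 \<or> \<sigma> i = - 1" for \<sigma> :: "13 \<Rightarrow> real"
      proof -
        have "card {i. \<sigma> i = - 1} \<le> 13" using card_mono[of UNIV "{i. \<sigma> i = - 1}"] by simp
        then show ?thesis unfolding sum_w[OF that] by (subst krawtchouk_13) auto
      qed
    qed
    then have "s ^ 13 * (2048 / 7 * Re (fourier g 0)) \<le> s ^ 13 * (8192 * f 0)"
      using s unfolding total by (intro mult_left_mono) (auto simp: g_def)
    then show ?thesis using at_0 unfolding s_def [symmetric] by (simp add: mult_ac)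
  qed
  then show "cohn_elkies_bound TYPE(13) r \<ge> ereal (1 / 28)"
    unfolding cohn_elkies_bound_def by (intro INF_greatest) simp
qed

end
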